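(* Let $L\colon\mathbf{Matr}\to\mathbf{GLat}$ be the functor sending a matroid $M$ to its lattice $L(M)$ of flats ordered by inclusion and a strong map $f\colon M\to N$ to the function $L(f)\colon L(M)\to L(N)$, $X\mapsto\mathrm{cl}(f(X))$. Then $L$ is nearly full. The analogous functor $L\colon\mathbf{Matr}_\bullet\to\mathbf{GLat}$, defined by the same formulas on pointed matroids and pointed strong maps, is full.
   Context: All matroids are finite. A strong map from $M$ to $N$ is a function $f\colon|M|\to|N|$ between ground sets such that the inverse image of any flat of $N$ is a flat of $M$; $\mathbf{Matr}$ is the category of matroids and strong maps. A pointed matroid is a matroid with a distinguished loop $\bullet$ (a loop is an element contained in every flat); $\mathbf{Matr}_\bullet$ is the category of pointed matroids and strong maps preserving the distinguished loop. $\mathrm{cl}$ denotes matroid closure. $\mathbf{GLat}$ is the category whose objects are (finite) geometric lattices and whose morphisms are functions that preserve joins (including the empty join, i.e. the least element) and that map every atom to either an atom or the least element; isomorphic lattices are identified. A functor $F\colon\mathbf{C}\to\mathbf{D}$ is nearly full when any morphism $g$ of $\mathbf{D}$ between objects in the image of $F$ is of the form $g=F(f)$ for some morphism $f$ of $\mathbf{C}$ (whose domain and codomain may be any objects of $\mathbf{C}$ with the required images). *)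

theory Defs
  imports "HOL-Library.FuncSet" "HOL-Algebra.Lattice"
begin

section \<open>Categories and functors\<close>

record ('o, 'm) cat =
  Ob :: "'o set"
  Hom :: "'o \<Rightarrow> 'o \<Rightarrow> 'm set"
  ident :: "'o \<Rightarrow> 'm"
  comp :: "'o \<Rightarrow> 'o \<Rightarrow> 'o \<Rightarrow> 'm \<Rightarrow> 'm \<Rightarrow> 'm"
    \<comment> \<open>\<open>comp C A B D g f\<close> is the composite of \<open>f\<close> from \<open>A\<close> to \<open>B\<close> followed by \<open>g\<close> from \<open>B\<close> to \<open>D\<close>;
      the objects are passed explicitly because the elements of \<open>Hom\<close> do not carry them.\<close>

locale category =
  fixes C :: "('o, 'm) cat"
  assumes ident_Hom: "A \<in> Ob C \<Longrightarrow> ident C A \<in> Hom C A A"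
    and comp_Hom: "\<lbrakk>A \<in> Ob C; B \<in> Ob C; D \<in> Ob C; f \<in> Hom C A B; g \<in> Hom C B D\<rbrakk>
      \<Longrightarrow> comp C A B D g f \<in> Hom C A D"
    and comp_ident_right: "\<lbrakk>A \<in> Ob C; B \<in> Ob C; f \<in> Hom C A B\<rbrakk> \<Longrightarrow> comp C A A B f (ident C A) = f"
    and comp_ident_left: "\<lbrakk>A \<in> Ob C; B \<in> Ob C; f \<in> Hom C A B\<rbrakk> \<Longrightarrow> comp C A B B (ident C B) f = f"
    and comp_assoc: "\<lbrakk>A \<in> Ob C; B \<in> Ob C; D \<in> Ob C; E \<in> Ob C;
        f \<in> Hom C A B; g \<in> Hom C B D; h \<in> Hom C D E\<rbrakk>
      \<Longrightarrow> comp C A B E (comp C B D E h g) f = comp C A D E h (comp C A B D g f)"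

record ('o, 'm, 'p, 'n) cat_map =
  on_Ob :: "'o \<Rightarrow> 'p"
  on_Hom :: "'o \<Rightarrow> 'o \<Rightarrow> 'm \<Rightarrow> 'n"

definition is_functor ::
  "('o, 'm) cat \<Rightarrow> ('p, 'n) cat \<Rightarrow> ('o, 'm, 'p, 'n) cat_map \<Rightarrow> bool" where
  "is_functor C D F \<longleftrightarrow> category C \<and> category D \<and>
     (\<forall>A \<in> Ob C. on_Ob F A \<in> Ob D) \<and>
     (\<forall>A \<in> Ob C. \<forall>B \<in> Ob C. \<forall>f \<in> Hom C A B. on_Hom F A B f \<in> Hom D (on_Ob F A) (on_Ob F B)) \<and>
     (\<forall>A \<in> Ob C. on_Hom F A A (ident C A) = ident D (on_Ob F A)) \<and>
     (\<forall>A \<in> Ob C. \<forall>B \<in> Ob C. \<forall>E \<in> Ob C. \<forall>f \<in> Hom C A B. \<forall>g \<in> Hom C B E.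
        on_Hom F A E (comp C A B E g f) =
        comp D (on_Ob F A) (on_Ob F B) (on_Ob F E) (on_Hom F B E g) (on_Hom F A B f))"

definition full_functor ::
  "('o, 'm) cat \<Rightarrow> ('p, 'n) cat \<Rightarrow> ('o, 'm, 'p, 'n) cat_map \<Rightarrow> bool" where
  "full_functor C D F \<longleftrightarrow>
     (\<forall>M \<in> Ob C. \<forall>N \<in> Ob C. \<forall>g \<in> Hom D (on_Ob F M) (on_Ob F N).
        \<exists>f \<in> Hom C M N. on_Hom F M N f = g)"

definition nearly_full ::
  "('o, 'm) cat \<Rightarrow> ('p, 'n) cat \<Rightarrow> ('o, 'm, 'p, 'n) cat_map \<Rightarrow> bool" where
  "nearly_full C D F \<longleftrightarrow>
     (\<forall>A \<in> on_Ob F ` Ob C. \<forall>B \<in> on_Ob F ` Ob C. \<forall>g \<in> Hom D A B.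
        \<exists>M \<in> Ob C. \<exists>N \<in> Ob C. \<exists>f \<in> Hom C M N.
          on_Ob F M = A \<and> on_Ob F N = B \<and> on_Hom F M N f = g)"


section \<open>Identifying isomorphic objects\<close>

definition inverse_pair :: "('o, 'm) cat \<Rightarrow> 'o \<Rightarrow> 'o \<Rightarrow> 'm \<Rightarrow> 'm \<Rightarrow> bool" where
  "inverse_pair C A B f g \<longleftrightarrow> f \<in> Hom C A B \<and> g \<in> Hom C B A \<and>
     comp C A B A g f = ident C A \<and> comp C B A B f g = ident C B"

definition Iso :: "('o, 'm) cat \<Rightarrow> 'o \<Rightarrow> 'o \<Rightarrow> 'm set" where
  "Iso C A B = {f. \<exists>g. inverse_pair C A B f g}"

definition inv_arrow :: "('o, 'm) cat \<Rightarrow> 'o \<Rightarrow> 'o \<Rightarrow> 'm \<Rightarrow> 'm" where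
  "inv_arrow C A B f = (THE g. inverse_pair C A B f g)"

text \<open>
  To identify isomorphic objects of \<open>C\<close> means to choose one object \<open>r A\<close> for all the objects
  isomorphic to \<open>A\<close>, together with an isomorphism \<open>i A\<close> from \<open>A\<close> to \<open>r A\<close> along which \<open>A\<close> is
  identified with \<open>r A\<close>. A functor into \<open>C\<close> then becomes a functor into the full subcategory on
  the chosen objects by transporting its values along these isomorphisms.
\<close>

definition identification :: "('o, 'm) cat \<Rightarrow> ('o \<Rightarrow> 'o) \<Rightarrow> ('o \<Rightarrow> 'm) \<Rightarrow> bool" where
  "identification C r i \<longleftrightarrow>
     (\<forall>A \<in> Ob C. r A \<in> Ob C \<and> i A \<in> Iso C A (r A)) \<and>
     (\<forall>A \<in> Ob C. \<forall>B \<in> Ob C. Iso C A B \<noteq> {} \<longrightarrow> r A = r B)"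

definition identified_cat :: "('o, 'm) cat \<Rightarrow> ('o \<Rightarrow> 'o) \<Rightarrow> ('o, 'm) cat" where
  "identified_cat C r = C\<lparr>Ob := r ` Ob C\<rparr>"

definition identified_functor ::
  "('p, 'n) cat \<Rightarrow> ('p \<Rightarrow> 'p) \<Rightarrow> ('p \<Rightarrow> 'n) \<Rightarrow> ('o, 'm, 'p, 'n) cat_map \<Rightarrow> ('o, 'm, 'p, 'n) cat_map" where
  "identified_functor D r i F =
     \<lparr>on_Ob = \<lambda>M. r (on_Ob F M),
      on_Hom = \<lambda>M N f. let A = on_Ob F M; B = on_Ob F N in
        comp D (r A) B (r B) (i B)
          (comp D (r A) A B (on_Hom F M N f) (inv_arrow D A (r A) (i A)))\<rparr>"

lemma identification_exists:
  assumes "category C"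
  shows "\<exists>r i. identification C r i"
proof -
  interpret category C by fact
  define r where "r A = (SOME B. B \<in> Ob C \<and> Iso C A B \<noteq> {})" for A
  define i where "i A = (SOME f. f \<in> Iso C A (r A))" for A
  have refl: "Iso C A A \<noteq> {}" if "A \<in> Ob C" for A
    using that ident_Hom comp_ident_left unfolding Iso_def inverse_pair_def by blast
  have sym: "Iso C B A \<noteq> {}" if "Iso C A B \<noteq> {}" for A B
    using that unfolding Iso_def inverse_pair_def by blast
  have trans: "Iso C A D \<noteq> {}"
    if ob: "A \<in> Ob C" "B \<in> Ob C" "D \<in> Ob C" and ne: "Iso C A B \<noteq> {}" "Iso C B D \<noteq> {}" for A B D
  proof -
    obtain f f' g g' where fg: "inverse_pair C A B f f'" "inverse_pair C B D g g'"
      using ne unfolding Iso_def by auto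
    have gen: "comp C P R P (comp C R Q P u' v') (comp C P Q R v u) = ident C P"
      if "P \<in> Ob C" "Q \<in> Ob C" "R \<in> Ob C"
        "inverse_pair C P Q u u'" "inverse_pair C Q R v v'" for P Q R u u' v v'
    proof -
      have h: "u \<in> Hom C P Q" "u' \<in> Hom C Q P" "v \<in> Hom C Q R" "v' \<in> Hom C R Q"
        "comp C P Q P u' u = ident C P" "comp C Q R Q v' v = ident C Q"
        using that unfolding inverse_pair_def by auto
      have "comp C P R P (comp C R Q P u' v') (comp C P Q R v u)
          = comp C P Q P u' (comp C P R Q v' (comp C P Q R v u))"
        using comp_assoc[of P R Q P "comp C P Q R v u" v' u'] that h comp_Hom by simp
      also have "comp C P R Q v' (comp C P Q R v u) = comp C P Q Q (comp C Q R Q v' v) u"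
        using comp_assoc[of P Q R Q u v v'] that h by simp
      also have "\<dots> = u"
        using that h comp_ident_left by simp
      finally show ?thesis
        using h by simp
    qed
    have "inverse_pair C A D (comp C A B D g f) (comp C D B A f' g')"
      using gen[OF ob fg] gen[of D B A g' g f' f] fg ob comp_Hom
      unfolding inverse_pair_def by simp
    then show ?thesis
      unfolding Iso_def by blast
  qed
  have r: "r A \<in> Ob C \<and> Iso C A (r A) \<noteq> {}" if "A \<in> Ob C" for A
    unfolding r_def by (rule someI[of _ A]) (use that refl in blast)
  have i: "i A \<in> Iso C A (r A)" if "A \<in> Ob C" for A
    using r[OF that] unfolding i_def by (simp add: some_in_eq)
  have "r A = r B" if "A \<in> Ob C" "B \<in> Ob C" "Iso C A B \<noteq> {}" for A B
  proof -
    have "(D \<in> Ob C \<and> Iso C A D \<noteq> {}) = (D \<in> Ob C \<and> Iso C B D \<noteq> {})" for D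
      using that sym trans by metis
    then show ?thesis
      unfolding r_def by simp
  qed
  then show ?thesis
    using r i unfolding identification_def by blast
qed


section \<open>Finite matroids and strong maps\<close>

record 'a matroid =
  ground :: "'a set"
  indep :: "'a set set"

locale matroid =
  fixes M :: "('a, 'r) matroid_scheme"
  assumes finite_ground: "finite (ground M)"
    and indep_subset: "I \<in> indep M \<Longrightarrow> I \<subseteq> ground M"
    and indep_empty: "{} \<in> indep M"
    and indep_mono: "\<lbrakk>I \<in> indep M; J \<subseteq> I\<rbrakk> \<Longrightarrow> J \<in> indep M"
    and augment: "\<lbrakk>I \<in> indep M; J \<in> indep M; card I < card J\<rbrakk> \<Longrightarrow> \<exists>x \<in> J - I. insert x I \<in> indep M"

definition rank :: "('a, 'r) matroid_scheme \<Rightarrow> 'a set \<Rightarrow> nat" where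
  "rank M X = Max (card ` {I \<in> indep M. I \<subseteq> X})"

definition cl :: "('a, 'r) matroid_scheme \<Rightarrow> 'a set \<Rightarrow> 'a set" where
  "cl M X = {x \<in> ground M. rank M (insert x X) = rank M X}"

definition flats :: "('a, 'r) matroid_scheme \<Rightarrow> 'a set set" where
  "flats M = {F. F \<subseteq> ground M \<and> cl M F = F}"

definition loops :: "('a, 'r) matroid_scheme \<Rightarrow> 'a set" where
  "loops M = {x \<in> ground M. \<forall>F \<in> flats M. x \<in> F}"

text \<open>
  Here and below, maps between carriers are extensional functions (\<open>\<rightarrow>\<^sub>E\<close>), so that
  equality of morphisms is equality in HOL.
\<close>

definition strong_maps ::
  "('a, 'r) matroid_scheme \<Rightarrow> ('b, 's) matroid_scheme \<Rightarrow> ('a \<Rightarrow> 'b) set" where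
  "strong_maps M N =
     {f \<in> ground M \<rightarrow>\<^sub>E ground N. \<forall>F \<in> flats N. {x \<in> ground M. f x \<in> F} \<in> flats M}"

record 'a pointed_matroid = "'a matroid" +
  point :: 'a

text \<open>
  The objects of \<open>Matr\<close> and \<open>Matr_pointed\<close> are the finite matroids with elements in the type
  \<open>'a\<close>. When \<open>'a\<close> is infinite, this includes every finite matroid up to isomorphism.
\<close>

definition Matr :: "('a matroid, 'a \<Rightarrow> 'a) cat" where
  "Matr =
     \<lparr>Ob = {M. matroid M},
      Hom = strong_maps,
      ident = \<lambda>M. \<lambda>x\<in>ground M. x,
      comp = \<lambda>M N P g f. compose (ground M) g f\<rparr>"

definition Matr_pointed :: "('a pointed_matroid, 'a \<Rightarrow> 'a) cat" where
  "Matr_pointed =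
     \<lparr>Ob = {M. matroid M \<and> point M \<in> loops M},
      Hom = \<lambda>M N. {f \<in> strong_maps M N. f (point M) = point N},
      ident = \<lambda>M. \<lambda>x\<in>ground M. x,
      comp = \<lambda>M N P g f. compose (ground M) g f\<rparr>"


section \<open>Finite geometric lattices\<close>

definition covers :: "('l, 'r) gorder_scheme \<Rightarrow> 'l \<Rightarrow> 'l \<Rightarrow> bool" where
  "covers L y x \<longleftrightarrow> x \<sqsubset>\<^bsub>L\<^esub> y \<and> \<not> (\<exists>z \<in> carrier L. x \<sqsubset>\<^bsub>L\<^esub> z \<and> z \<sqsubset>\<^bsub>L\<^esub> y)"

definition atoms :: "('l, 'r) gorder_scheme \<Rightarrow> 'l set" where
  "atoms L = {a \<in> carrier L. covers L a \<bottom>\<^bsub>L\<^esub>}"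

locale geometric_lattice = bounded_lattice L for L (structure) +
  assumes finite_carrier: "finite (carrier L)"
    and atomistic: "x \<in> carrier L \<Longrightarrow> \<exists>S \<subseteq> atoms L. x = \<Squnion>\<^bsub>L\<^esub> S"
    and semimodular: "\<lbrakk>x \<in> carrier L; y \<in> carrier L; covers L x (x \<sqinter>\<^bsub>L\<^esub> y)\<rbrakk>
      \<Longrightarrow> covers L (x \<squnion>\<^bsub>L\<^esub> y) y"

definition GLat :: "('l gorder, 'l \<Rightarrow> 'l) cat" where
  "GLat =
     \<lparr>Ob = {A. geometric_lattice A},
      Hom = \<lambda>A B. {g \<in> carrier A \<rightarrow>\<^sub>E carrier B.
              (\<forall>S \<subseteq> carrier A. g (\<Squnion>\<^bsub>A\<^esub> S) = \<Squnion>\<^bsub>B\<^esub> (g ` S)) \<and>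
              (\<forall>a \<in> atoms A. g a \<in> atoms B \<or> g a = \<bottom>\<^bsub>B\<^esub>)},
      ident = \<lambda>A. \<lambda>x\<in>carrier A. x,
      comp = \<lambda>A B D g f. compose (carrier A) g f\<rparr>"


section \<open>The lattice of flats\<close>

definition flat_lattice :: "('a, 'r) matroid_scheme \<Rightarrow> 'a set gorder" where
  "flat_lattice M = \<lparr>carrier = flats M, eq = (=), le = (\<subseteq>)\<rparr>"

definition flat_functor ::
  "(('a, 'r) matroid_scheme, 'a \<Rightarrow> 'a, 'a set gorder, 'a set \<Rightarrow> 'a set) cat_map" where
  "flat_functor =
     \<lparr>on_Ob = flat_lattice,
      on_Hom = \<lambda>M N f. \<lambda>X\<in>flats M. cl N (f ` X)\<rparr>"

abbreviation L_Matr :: "('a matroid, 'a \<Rightarrow> 'a, 'a set gorder, 'a set \<Rightarrow> 'a set) cat_map" where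
  "L_Matr \<equiv> flat_functor"

abbreviation L_pointed ::
  "('a pointed_matroid, 'a \<Rightarrow> 'a, 'a set gorder, 'a set \<Rightarrow> 'a set) cat_map" where
  "L_pointed \<equiv> flat_functor"

end

theory Submission
  imports Defs
begin

text \<open>
  A join-preserving map out of a lattice of flats is determined by its values on the closures of
  single elements, and a morphism of geometric lattices sends each such closure to an atom or to
  the least element. An atom of \<open>L(N)\<close> is the closure of a single element of \<open>N\<close>, and the least
  element is the closure of a loop if \<open>N\<close> has one. So, given \<open>h\<close> from \<open>L(M)\<close> to \<open>L(N)\<close> and a loop
  \<open>c\<close> of \<open>N\<close>, there is a function \<open>f\<close> on elements with \<open>cl {f x} = h (cl {x})\<close>, where \<open>c\<close> serves
  whenever the right-hand side is the least element. Passing to joins gives \<open>L(f) = h\<close>. The function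
  is strong since the preimage of a flat \<open>F\<close> is the largest flat that \<open>h\<close> sends below \<open>F\<close>, which
  exists because \<open>h\<close> preserves joins. This is \<open>strong_map_of_GLat_map\<close>.

  In the pointed case the target has a distinguished loop, and every loop of \<open>M\<close> may be sent to it,
  so the functor is full. A matroid without loops cannot receive a map that collapses an atom; but
  adjoining a loop does not change the lattice of flats up to isomorphism (\<open>Iso_add_loop\<close>), and
  near fullness permits this replacement once isomorphic lattices are identified.

  It is essential that the loop is adjoined before the given morphism is carried back along the
  identification: the isomorphisms from \<open>L(N)\<close> and from \<open>L(N')\<close> to their common representative
  may differ by an automorphism. Carrying back along the isomorphism that belongs to \<open>N'\<close> makes
  this harmless, because the lifting applies to every morphism between the two lattices.

  That the lattice of flats is geometric rests on the exchange property of the closure operator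
  (\<open>covers_cl_insert\<close>); functoriality rests on \<open>cl (f (cl X)) = cl (f X)\<close> for a strong map \<open>f\<close>
  (\<open>strong_map_cl_image\<close>).
\<close>

section \<open>Rank and closure\<close>

context matroid
begin

lemma finite_indep: "finite {I \<in> indep M. I \<subseteq> X}"
  by (rule finite_subset[of _ "Pow (ground M)"]) (use indep_subset finite_ground in auto)

lemma finite_indep_member: "I \<in> indep M \<Longrightarrow> finite I"
  using indep_subset finite_ground finite_subset by blast

lemma card_le_rank: "\<lbrakk>I \<in> indep M; I \<subseteq> X\<rbrakk> \<Longrightarrow> card I \<le> rank M X"
  unfolding rank_def using finite_indep by (intro Max_ge) auto

definition basis_of :: "'a set \<Rightarrow> 'a set \<Rightarrow> bool" where
  "basis_of X B \<longleftrightarrow> B \<in> indep M \<and> B \<subseteq> X \<and> card B = rank M X"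

lemma basis_exists: "\<exists>B. basis_of X B"
proof -
  have "rank M X \<in> card ` {I \<in> indep M. I \<subseteq> X}"
    unfolding rank_def by (rule Max_in) (use finite_indep indep_empty in auto)
  then show ?thesis
    unfolding basis_of_def by force
qed

lemma extend_to_basis:
  assumes "I \<in> indep M" "I \<subseteq> X"
  shows "\<exists>B. I \<subseteq> B \<and> basis_of X B"
  using assms
proof (induction "rank M X - card I" arbitrary: I rule: less_induct)
  case less
  show ?case
  proof (cases "card I = rank M X")
    case True
    then show ?thesis using less.prems unfolding basis_of_def by blast
  next
    case False
    then have lt: "card I < rank M X"
      using card_le_rank less.prems by (simp add: order_less_le)
    obtain B where "B \<in> indep M" "B \<subseteq> X" "card B = rank M X"
      using basis_exists unfolding basis_of_def by blast
    then obtain x where x: "x \<in> B - I" "insert x I \<in> indep M" "x \<in> X"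
      using augment[of I B] less.prems lt by auto
    then have "rank M X - card (insert x I) < rank M X - card I"
      using finite_indep_member less.prems lt by simp
    then have "\<exists>B. insert x I \<subseteq> B \<and> basis_of X B"
      using x less.prems by (intro less.hyps) auto
    then show ?thesis
      by blast
  qed
qed

lemma rank_mono: "X \<subseteq> Y \<Longrightarrow> rank M X \<le> rank M Y"
  using basis_exists[of X] card_le_rank[of _ Y] unfolding basis_of_def by fastforce

lemma rank_insert_le: "rank M (insert x X) \<le> Suc (rank M X)"
proof -
  obtain B where B: "B \<in> indep M" "B \<subseteq> insert x X" "card B = rank M (insert x X)"
    using basis_exists unfolding basis_of_def by blast
  have "card (B - {x}) \<le> rank M X"
    using B by (intro card_le_rank indep_mono[OF B(1)]) auto
  then show ?thesis
    using B(3) card_Diff_singleton_if[of B x] by (auto split: if_splits)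
qed

text \<open>
  Closure membership can be tested on any one basis: a set of larger rank would, by augmentation,
  extend that particular basis. This reduces every closure axiom to bookkeeping with a basis.
\<close>

lemma mem_cl_iff_basis:
  assumes B: "basis_of X B"
  shows "x \<in> cl M X \<longleftrightarrow> x \<in> ground M \<and> (x \<in> B \<or> insert x B \<notin> indep M)"
proof -
  have B': "B \<in> indep M" "B \<subseteq> X" "card B = rank M X"
    using B unfolding basis_of_def by auto
  have "rank M (insert x X) = rank M X \<longleftrightarrow> x \<in> B \<or> insert x B \<notin> indep M"
  proof
    assume eq: "rank M (insert x X) = rank M X"
    show "x \<in> B \<or> insert x B \<notin> indep M"
    proof (rule ccontr)
      assume neg: "\<not> ?thesis"
      then have "card (insert x B) \<le> rank M (insert x X)"
        using B' by (intro card_le_rank) auto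
      then show False
        using neg eq B' finite_indep_member by simp
    qed
  next
    assume or: "x \<in> B \<or> insert x B \<notin> indep M"
    show "rank M (insert x X) = rank M X"
    proof (rule ccontr)
      assume "\<not> ?thesis"
      then have lt: "card B < rank M (insert x X)"
        using rank_mono[OF subset_insertI, of X x] B' by simp
      obtain C where C: "C \<in> indep M" "C \<subseteq> insert x X" "card C = rank M (insert x X)"
        using basis_exists unfolding basis_of_def by blast
      then obtain y where y: "y \<in> C - B" "insert y B \<in> indep M"
        using augment[of B C] B' lt by auto
      then have "y \<noteq> x"
        using or by auto
      then have "card (insert y B) \<le> rank M X"
        using y C B' by (intro card_le_rank) auto
      then show False
        using y B' finite_indep_member by simp
    qed
  qed
  then show ?thesis
    unfolding cl_def by simp
qed

lemma cl_ground: "cl M X \<subseteq> ground M"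
  unfolding cl_def by blast

lemma cl_superset: "X \<subseteq> ground M \<Longrightarrow> X \<subseteq> cl M X"
  unfolding cl_def by (auto simp: insert_absorb)

lemma cl_mono:
  assumes "X \<subseteq> Y"
  shows "cl M X \<subseteq> cl M Y"
proof
  fix x assume x: "x \<in> cl M X"
  obtain B where B: "basis_of X B"
    using basis_exists by blast
  then obtain C where C: "B \<subseteq> C" "basis_of Y C"
    using extend_to_basis[of B Y] assms unfolding basis_of_def by blast
  have "insert x C \<notin> indep M" if "insert x B \<notin> indep M"
    using that C(1) indep_mono[of "insert x C" "insert x B"] by blast
  then show "x \<in> cl M Y"
    using x C(1) mem_cl_iff_basis[OF B] mem_cl_iff_basis[OF C(2)] by blast
qed

lemma cl_cl:
  assumes "X \<subseteq> ground M"
  shows "cl M (cl M X) = cl M X"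
proof -
  obtain B where B: "basis_of X B"
    using basis_exists by blast
  have B': "B \<in> indep M" "B \<subseteq> cl M X"
    using B cl_superset[OF assms] unfolding basis_of_def by auto
  \<comment> \<open>A basis of \<open>X\<close> cannot be augmented inside the closure, so it is still a basis there.\<close>
  obtain C where C: "B \<subseteq> C" "basis_of (cl M X) C"
    using extend_to_basis B' by blast
  have "C \<subseteq> B"
  proof
    fix x assume "x \<in> C"
    then have "insert x B \<in> indep M" "x \<in> cl M X"
      using C indep_mono[of C "insert x B"] unfolding basis_of_def by auto
    then show "x \<in> B"
      using mem_cl_iff_basis[OF B] by blast
  qed
  then have "basis_of (cl M X) B"
    using C by (simp add: subset_antisym)
  then show ?thesis
    using mem_cl_iff_basis B by blast
qed

lemma cl_exchange:
  assumes "y \<in> cl M (insert x X)" "y \<notin> cl M X" "x \<in> ground M"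
  shows "x \<in> cl M (insert y X)"
proof -
  have y: "y \<in> ground M" "rank M (insert y (insert x X)) = rank M (insert x X)"
    "rank M (insert y X) \<noteq> rank M X"
    using assms unfolding cl_def by auto
  have "rank M (insert x (insert y X)) = rank M (insert y X)"
    using y rank_insert_le[of x X] rank_mono[OF subset_insertI, of X y]
      rank_mono[OF subset_insertI, of "insert y X" x]
    by (simp add: insert_commute)
  then show ?thesis
    using assms(3) unfolding cl_def by simp
qed

section \<open>The lattice of flats\<close>

lemma flats_ground: "F \<in> flats M \<Longrightarrow> F \<subseteq> ground M"
  unfolding flats_def by blast

lemma cl_flat: "F \<in> flats M \<Longrightarrow> cl M F = F"
  unfolding flats_def by blast

lemma cl_in_flats: "X \<subseteq> ground M \<Longrightarrow> cl M X \<in> flats M"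
  unfolding flats_def using cl_ground by (simp add: cl_cl)

lemma cl_subset_flat_iff: "\<lbrakk>X \<subseteq> ground M; F \<in> flats M\<rbrakk> \<Longrightarrow> cl M X \<subseteq> F \<longleftrightarrow> X \<subseteq> F"
  by (metis cl_flat cl_mono cl_superset subset_trans)

lemma ground_in_flats: "ground M \<in> flats M"
  using cl_in_flats[of "ground M"] cl_superset[of "ground M"] cl_ground[of "ground M"] by auto

lemma Int_in_flats:
  assumes "F \<in> flats M" "G \<in> flats M"
  shows "F \<inter> G \<in> flats M"
proof -
  have "F \<inter> G \<subseteq> ground M"
    using assms flats_ground by blast
  moreover have "cl M (F \<inter> G) \<subseteq> F \<inter> G"
    using cl_mono[of "F \<inter> G" F] cl_mono[of "F \<inter> G" G] assms[THEN cl_flat] by simp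
  ultimately show ?thesis
    using cl_superset unfolding flats_def by blast
qed

lemma finite_flats: "finite (flats M)"
  by (rule finite_subset[of _ "Pow (ground M)"]) (use flats_ground finite_ground in auto)

lemma cl_empty_subset_flat: "F \<in> flats M \<Longrightarrow> cl M {} \<subseteq> F"
  using cl_mono[of "{}" F] cl_flat by auto

lemma loops_eq_cl_empty: "loops M = cl M {}"
  using cl_empty_subset_flat cl_in_flats[of "{}"] cl_ground[of "{}"] unfolding loops_def by blast

lemma cl_Un_cl:
  assumes "X \<subseteq> ground M" "Y \<subseteq> ground M"
  shows "cl M (cl M X \<union> Y) = cl M (X \<union> Y)"
proof
  have "cl M X \<union> Y \<subseteq> cl M (X \<union> Y)"
    using cl_mono[of X "X \<union> Y"] cl_superset[of "X \<union> Y"] assms by blast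
  then show "cl M (cl M X \<union> Y) \<subseteq> cl M (X \<union> Y)"
    using cl_mono[of "cl M X \<union> Y" "cl M (X \<union> Y)"] cl_cl[of "X \<union> Y"] assms by simp
  show "cl M (X \<union> Y) \<subseteq> cl M (cl M X \<union> Y)"
    using cl_superset[of X] assms by (intro cl_mono) auto
qed

lemma cl_UN_cl:
  assumes "\<And>i. i \<in> I \<Longrightarrow> A i \<subseteq> ground M"
  shows "cl M (\<Union>i\<in>I. cl M (A i)) = cl M (\<Union>i\<in>I. A i)"
proof
  have ground: "(\<Union>i\<in>I. A i) \<subseteq> ground M"
    using assms by blast
  have "(\<Union>i\<in>I. cl M (A i)) \<subseteq> cl M (\<Union>i\<in>I. A i)"
    by (intro UN_least cl_mono) auto
  then show "cl M (\<Union>i\<in>I. cl M (A i)) \<subseteq> cl M (\<Union>i\<in>I. A i)"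
    using cl_mono[of "\<Union>i\<in>I. cl M (A i)"] cl_cl[OF ground] by metis
  show "cl M (\<Union>i\<in>I. A i) \<subseteq> cl M (\<Union>i\<in>I. cl M (A i))"
    using assms by (intro cl_mono UN_mono cl_superset) auto
qed

text \<open>
  There is no flat strictly between \<open>F\<close> and the closure of \<open>insert x F\<close>: any new element \<open>z\<close> of such
  a flat can be exchanged for \<open>x\<close>.
\<close>

lemma flat_eq_cl_insert:
  assumes F: "F \<in> flats M" and G: "G \<in> flats M"
    and z: "z \<in> G" "z \<notin> F" "F \<subseteq> G" and sub: "G \<subseteq> cl M (insert x F)" and x: "x \<in> ground M"
  shows "G = cl M (insert x F)"
proof -
  have ground: "insert z F \<subseteq> ground M" "insert x F \<subseteq> ground M"
    using F G z x flats_ground by blast+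
  have "z \<in> cl M (insert x F)" "z \<notin> cl M F"
    using z sub cl_flat[OF F] by auto
  from cl_exchange[OF this x] have "x \<in> cl M (insert z F)" .
  moreover have "cl M (insert z F) \<subseteq> G"
    using z cl_subset_flat_iff[OF ground(1) G] by simp
  ultimately have "insert x F \<subseteq> G"
    using z by auto
  then have "cl M (insert x F) \<subseteq> G"
    using cl_subset_flat_iff[OF ground(2) G] by simp
  then show ?thesis
    using sub by simp
qed

end

lemma carrier_flat_lattice [simp]: "carrier (flat_lattice M) = flats M"
  and le_flat_lattice [simp]: "le (flat_lattice M) = (\<subseteq>)"
  and eq_flat_lattice [simp]: "eq (flat_lattice M) = (=)"
  by (simp_all add: flat_lattice_def)

lemma lless_flat_lattice: "X \<sqsubset>\<^bsub>flat_lattice M\<^esub> Y \<longleftrightarrow> X \<subset> Y"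
  unfolding lless_def by auto

lemma covers_flat_lattice:
  "covers (flat_lattice M) Y X \<longleftrightarrow> X \<subset> Y \<and> \<not> (\<exists>Z \<in> flats M. X \<subset> Z \<and> Z \<subset> Y)"
  unfolding covers_def by (simp add: lless_flat_lattice)

lemma partial_order_flat_lattice: "partial_order (flat_lattice M)"
  by unfold_locales auto

lemma (in partial_order) sup_eqI: "least L s (Upper L S) \<Longrightarrow> \<Squnion>\<^bsub>L\<^esub> S = s"
  unfolding sup_def by (rule some_equality) (auto dest: least_unique)

lemma (in partial_order) inf_eqI: "greatest L s (Lower L S) \<Longrightarrow> \<Sqinter>\<^bsub>L\<^esub> S = s"
  unfolding inf_def by (rule some_equality) (auto dest: greatest_unique)

context matroid
begin

lemma least_flat_lattice:
  assumes "S \<subseteq> flats M"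
  shows "least (flat_lattice M) (cl M (\<Union>S)) (Upper (flat_lattice M) S)"
proof -
  have S: "\<Union>S \<subseteq> ground M"
    using assms flats_ground by blast
  then show ?thesis
    using assms cl_superset[OF S] cl_in_flats[OF S] cl_subset_flat_iff[OF S]
    unfolding least_def Upper_def by auto
qed

lemma sup_flat_lattice: "S \<subseteq> flats M \<Longrightarrow> \<Squnion>\<^bsub>flat_lattice M\<^esub> S = cl M (\<Union>S)"
  by (rule partial_order.sup_eqI[OF partial_order_flat_lattice least_flat_lattice])

lemma greatest_flat_lattice:
  assumes "X \<in> flats M" "Y \<in> flats M"
  shows "greatest (flat_lattice M) (X \<inter> Y) (Lower (flat_lattice M) {X, Y})"
  using assms Int_in_flats unfolding greatest_def Lower_def by auto

lemma meet_flat_lattice: "\<lbrakk>X \<in> flats M; Y \<in> flats M\<rbrakk> \<Longrightarrow> X \<sqinter>\<^bsub>flat_lattice M\<^esub> Y = X \<inter> Y"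
  unfolding meet_def
  by (rule partial_order.inf_eqI[OF partial_order_flat_lattice greatest_flat_lattice])

lemma join_flat_lattice: "\<lbrakk>X \<in> flats M; Y \<in> flats M\<rbrakk> \<Longrightarrow> X \<squnion>\<^bsub>flat_lattice M\<^esub> Y = cl M (X \<union> Y)"
  unfolding join_def by (simp add: sup_flat_lattice)

lemma bottom_flat_lattice: "\<bottom>\<^bsub>flat_lattice M\<^esub> = cl M {}"
proof -
  have "least (flat_lattice M) (cl M {}) (flats M)"
    using cl_in_flats[of "{}"] cl_empty_subset_flat unfolding least_def by auto
  then show ?thesis
    unfolding bottom_def carrier_flat_lattice
    by (intro some_equality) (auto dest: partial_order.least_unique[OF partial_order_flat_lattice])
qed

text \<open>
  The exchange axiom in order-theoretic form. Both semimodularity and the description of the atoms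
  are instances.
\<close>

lemma covers_cl_insert:
  assumes F: "F \<in> flats M" and x: "x \<in> ground M" "x \<notin> F"
  shows "covers (flat_lattice M) (cl M (insert x F)) F"
proof -
  have "insert x F \<subseteq> cl M (insert x F)"
    using F x flats_ground by (intro cl_superset) auto
  moreover have "\<not> Z \<subset> cl M (insert x F)" if "Z \<in> flats M" "F \<subset> Z" for Z
    using that flat_eq_cl_insert[OF F that(1) _ _ _ _ x(1)] by blast
  ultimately show ?thesis
    using x unfolding covers_flat_lattice by blast
qed

lemma covers_flatD:
  assumes X: "X \<in> flats M" and Y: "Y \<in> flats M" and cov: "covers (flat_lattice M) Y X"
    and x: "x \<in> Y" "x \<notin> X"
  shows "Y = cl M (insert x X)"
proof -
  have xX: "insert x X \<subseteq> ground M"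
    using X Y x flats_ground by blast
  have "cl M (insert x X) \<subseteq> Y"
    using cov x cl_subset_flat_iff[OF xX Y] unfolding covers_flat_lattice by auto
  moreover have "X \<subset> cl M (insert x X)"
    using cl_superset[OF xX] x by blast
  ultimately show ?thesis
    using cov cl_in_flats[OF xX] unfolding covers_flat_lattice by blast
qed

lemma cl_singleton_atom:
  assumes "x \<in> ground M" "x \<notin> cl M {}"
  shows "cl M {x} \<in> atoms (flat_lattice M)"
proof -
  have "cl M (insert x (cl M {})) = cl M {x}"
    using cl_Un_cl[of "{}" "{x}"] assms by simp
  then show ?thesis
    using covers_cl_insert[of "cl M {}" x] assms cl_in_flats[of "{}"] cl_in_flats[of "{x}"]
    unfolding atoms_def bottom_flat_lattice by simp
qed

lemma atom_eq_cl_singleton: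
  assumes A: "A \<in> atoms (flat_lattice M)" and x: "x \<in> A" "x \<notin> cl M {}"
  shows "A = cl M {x}"
proof -
  have A': "A \<in> flats M" "covers (flat_lattice M) A (cl M {})"
    using A unfolding atoms_def bottom_flat_lattice by auto
  have "cl M (insert x (cl M {})) = cl M {x}"
    using cl_Un_cl[of "{}" "{x}"] x A' flats_ground by auto
  then show ?thesis
    using covers_flatD[OF _ A'] x cl_in_flats[of "{}"] by simp
qed

lemma atom_not_subset_cl_empty:
  "A \<in> atoms (flat_lattice M) \<Longrightarrow> \<exists>x \<in> A. x \<notin> cl M {}"
  unfolding atoms_def bottom_flat_lattice covers_flat_lattice by blast

lemma cl_singleton_atom_or_bottom:
  assumes "x \<in> ground M"
  shows "cl M {x} \<in> atoms (flat_lattice M) \<or> cl M {x} = \<bottom>\<^bsub>flat_lattice M\<^esub>"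
proof (cases "x \<in> cl M {}")
  case True
  then have "cl M {x} = cl M {}"
    using cl_subset_flat_iff[of "{x}" "cl M {}"] cl_in_flats[of "{}"] assms cl_mono[of "{}" "{x}"]
    by auto
  then show ?thesis
    by (simp add: bottom_flat_lattice)
qed (use assms cl_singleton_atom in blast)

lemma geometric_lattice_flats: "geometric_lattice (flat_lattice M)"
proof -
  interpret partial_order "flat_lattice M"
    by (rule partial_order_flat_lattice)
  show ?thesis
  proof unfold_locales
    fix X Y assume "X \<in> carrier (flat_lattice M)" "Y \<in> carrier (flat_lattice M)"
    then have XY: "X \<in> flats M" "Y \<in> flats M"
      by simp_all
    show "\<exists>s. least (flat_lattice M) s (Upper (flat_lattice M) {X, Y})"
      using least_flat_lattice[of "{X, Y}"] XY by blast
    show "\<exists>s. greatest (flat_lattice M) s (Lower (flat_lattice M) {X, Y})"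
      using greatest_flat_lattice XY by blast
    assume "covers (flat_lattice M) X (X \<sqinter>\<^bsub>flat_lattice M\<^esub> Y)"
    then have cov: "covers (flat_lattice M) X (X \<inter> Y)"
      by (simp add: meet_flat_lattice XY)
    then obtain x where x: "x \<in> X" "x \<notin> Y"
      unfolding covers_flat_lattice by blast
    have xg: "{x} \<union> (X \<inter> Y) \<subseteq> ground M" "Y \<subseteq> ground M"
      using x XY flats_ground by blast+
    have "X = cl M ({x} \<union> (X \<inter> Y))"
      using covers_flatD[OF Int_in_flats[OF XY] XY(1) cov, of x] x by simp
    then have "cl M (X \<union> Y) = cl M ({x} \<union> (X \<inter> Y) \<union> Y)"
      using cl_Un_cl[OF xg] by simp
    also have "{x} \<union> (X \<inter> Y) \<union> Y = insert x Y"
      by blast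
    finally show "covers (flat_lattice M) (X \<squnion>\<^bsub>flat_lattice M\<^esub> Y) Y"
      using covers_cl_insert[OF XY(2), of x] x xg by (simp add: join_flat_lattice XY)
  next
    show "\<exists>b. least (flat_lattice M) b (carrier (flat_lattice M))"
      using least_flat_lattice[of "{}"] by auto
    show "\<exists>t. greatest (flat_lattice M) t (carrier (flat_lattice M))"
      using ground_in_flats flats_ground unfolding greatest_def by auto
    show "finite (carrier (flat_lattice M))"
      by (simp add: finite_flats)
  next
    fix X assume "X \<in> carrier (flat_lattice M)"
    then have X: "X \<in> flats M" "X \<subseteq> ground M"
      using flats_ground by auto
    define T where "T = X - cl M {}"
    have T: "T \<subseteq> ground M"
      using X unfolding T_def by blast
    \<comment> \<open>Only the non-loops of \<open>X\<close> yield atoms, but these still span \<open>X\<close>.\<close>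
    have "cl M T = cl M (cl M {} \<union> T)"
      using cl_Un_cl[of "{}" T] T by simp
    also have "cl M {} \<union> T = X"
      unfolding T_def using cl_empty_subset_flat X by blast
    finally have "cl M (\<Union>x\<in>T. cl M {x}) = X"
      using cl_UN_cl[of T "\<lambda>x. {x}"] T X cl_flat by auto
    moreover have at: "(\<lambda>x. cl M {x}) ` T \<subseteq> atoms (flat_lattice M)"
      using cl_singleton_atom T unfolding T_def by blast
    ultimately have "X = \<Squnion>\<^bsub>flat_lattice M\<^esub> ((\<lambda>x. cl M {x}) ` T)"
      using sup_flat_lattice[of "(\<lambda>x. cl M {x}) ` T"] unfolding atoms_def by auto
    then show "\<exists>S\<subseteq>atoms (flat_lattice M). X = \<Squnion>\<^bsub>flat_lattice M\<^esub> S"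
      using at by blast
  qed
qed

end


section \<open>The category of geometric lattices\<close>

lemma Ob_GLat [simp]: "Ob GLat = {A. geometric_lattice A}"
  and ident_GLat [simp]: "ident GLat A = (\<lambda>x\<in>carrier A. x)"
  and comp_GLat [simp]: "comp GLat A B D g f = compose (carrier A) g f"
  by (simp_all add: GLat_def)

lemma mem_Hom_GLat_iff:
  "g \<in> Hom GLat A B \<longleftrightarrow> g \<in> carrier A \<rightarrow>\<^sub>E carrier B \<and>
     (\<forall>S \<subseteq> carrier A. g (\<Squnion>\<^bsub>A\<^esub> S) = \<Squnion>\<^bsub>B\<^esub> (g ` S)) \<and>
     (\<forall>a \<in> atoms A. g a \<in> atoms B \<or> g a = \<bottom>\<^bsub>B\<^esub>)"
  by (simp add: GLat_def)

lemma sup_empty: "\<Squnion>\<^bsub>L\<^esub> {} = \<bottom>\<^bsub>L\<^esub>"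
  unfolding sup_def bottom_def by simp

lemma Hom_GLat_bottom: "g \<in> Hom GLat A B \<Longrightarrow> g \<bottom>\<^bsub>A\<^esub> = \<bottom>\<^bsub>B\<^esub>"
  unfolding mem_Hom_GLat_iff by (metis empty_subsetI image_empty sup_empty)

context geometric_lattice
begin

lemma sup_least: "S \<subseteq> carrier L \<Longrightarrow> least L (\<Squnion>S) (Upper L S)"
  by (cases "S = {}") (auto simp: sup_empty bottom_least intro: finite_sup_least finite_subset[OF _ finite_carrier])

lemma sup_carrier: "S \<subseteq> carrier L \<Longrightarrow> \<Squnion>S \<in> carrier L"
  using sup_least by blast

end

lemma compose_in_Hom_GLat:
  assumes A: "geometric_lattice A" and f: "f \<in> Hom GLat A B" and g: "g \<in> Hom GLat B D"
  shows "compose (carrier A) g f \<in> Hom GLat A D"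
proof -
  interpret A: geometric_lattice A by fact
  have f': "f \<in> carrier A \<rightarrow> carrier B" and g': "g \<in> carrier B \<rightarrow> carrier D"
    using f g unfolding mem_Hom_GLat_iff by auto
  have "compose (carrier A) g f (\<Squnion>\<^bsub>A\<^esub> S) = \<Squnion>\<^bsub>D\<^esub> (compose (carrier A) g f ` S)"
    if S: "S \<subseteq> carrier A" for S
  proof -
    have "compose (carrier A) g f (\<Squnion>\<^bsub>A\<^esub> S) = g (\<Squnion>\<^bsub>B\<^esub> (f ` S))"
      using f S A.sup_carrier[OF S] unfolding mem_Hom_GLat_iff by (simp add: compose_eq)
    also have "\<dots> = \<Squnion>\<^bsub>D\<^esub> (g ` f ` S)"
    proof -
      have "f ` S \<subseteq> carrier B"
        using f' S by blast
      then show ?thesis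
        using g unfolding mem_Hom_GLat_iff by blast
    qed
    also have "g ` f ` S = compose (carrier A) g f ` S"
      using S unfolding image_image by (intro image_cong) (auto simp: compose_eq)
    finally show ?thesis .
  qed
  moreover have "compose (carrier A) g f a \<in> atoms D \<or> compose (carrier A) g f a = \<bottom>\<^bsub>D\<^esub>"
    if a: "a \<in> atoms A" for a
  proof -
    have "a \<in> carrier A"
      using a unfolding atoms_def by simp
    moreover have "f a \<in> atoms B \<or> f a = \<bottom>\<^bsub>B\<^esub>"
      using f a unfolding mem_Hom_GLat_iff by simp
    moreover have "g (f a) \<in> atoms D \<or> g (f a) = \<bottom>\<^bsub>D\<^esub>" if "f a \<in> atoms B"
      using g that unfolding mem_Hom_GLat_iff by simp
    ultimately show ?thesis
      using Hom_GLat_bottom[OF g] by (auto simp: compose_eq)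
  qed
  moreover have "compose (carrier A) g f \<in> carrier A \<rightarrow>\<^sub>E carrier D"
    using f' g' by (auto simp: compose_def)
  ultimately show ?thesis
    unfolding mem_Hom_GLat_iff by blast
qed

lemma category_GLat: "category GLat"
proof
  fix A assume "A \<in> Ob (GLat :: ('a gorder, 'a \<Rightarrow> 'a) cat)"
  then interpret A: geometric_lattice A by simp
  show "ident GLat A \<in> Hom GLat A A"
    unfolding mem_Hom_GLat_iff
  proof (intro conjI allI impI ballI)
    fix S assume S: "S \<subseteq> carrier A"
    then have "ident GLat A ` S = S"
      by (auto simp: image_iff subset_iff)
    then show "ident GLat A (\<Squnion>\<^bsub>A\<^esub> S) = \<Squnion>\<^bsub>A\<^esub> (ident GLat A ` S)"
      using A.sup_carrier[OF S] by simp
  qed (auto simp: atoms_def)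
next
  fix A B D :: "'a gorder" and f g
  assume "A \<in> Ob GLat" "f \<in> Hom GLat A B" "g \<in> Hom GLat B D"
  then show "comp GLat A B D g f \<in> Hom GLat A D"
    using compose_in_Hom_GLat by simp
next
  fix A B D E :: "'a gorder" and f g h
  assume "f \<in> Hom GLat A B"
  then have f: "f \<in> carrier A \<rightarrow>\<^sub>E carrier B"
    unfolding mem_Hom_GLat_iff by blast
  then show "comp GLat A A B f (ident GLat A) = f" "comp GLat A B B (ident GLat B) f = f"
    by (auto simp: compose_Id Id_compose PiE_def)
  show "comp GLat A B E (comp GLat B D E h g) f = comp GLat A D E h (comp GLat A B D g f)"
    using f by (auto simp: PiE_def compose_assoc)
qed

text \<open>
  Joins, atoms and the least element are all determined by the order alone.
\<close>

lemma order_iso_in_Hom_GLat: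
  assumes A: "geometric_lattice A" and B: "geometric_lattice B"
    and bij: "bij_betw f (carrier A) (carrier B)"
    and ord: "\<And>x y. \<lbrakk>x \<in> carrier A; y \<in> carrier A\<rbrakk> \<Longrightarrow> f x \<sqsubseteq>\<^bsub>B\<^esub> f y \<longleftrightarrow> x \<sqsubseteq>\<^bsub>A\<^esub> y"
  shows "restrict f (carrier A) \<in> Hom GLat A B"
proof -
  interpret A: geometric_lattice A by fact
  interpret B: geometric_lattice B by fact
  have img: "f ` carrier A = carrier B" and inj: "inj_on f (carrier A)"
    using bij unfolding bij_betw_def by auto
  have fc: "f x \<in> carrier B" if "x \<in> carrier A" for x
    using that img by blast
  have sup: "f (\<Squnion>\<^bsub>A\<^esub> S) = \<Squnion>\<^bsub>B\<^esub> (f ` S)" if S: "S \<subseteq> carrier A" for S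
  proof (rule B.sup_eqI[symmetric])
    have lA: "\<Squnion>\<^bsub>A\<^esub> S \<in> carrier A" "\<And>x. x \<in> S \<Longrightarrow> x \<sqsubseteq>\<^bsub>A\<^esub> \<Squnion>\<^bsub>A\<^esub> S"
      "\<And>y. \<lbrakk>y \<in> carrier A; \<And>x. x \<in> S \<Longrightarrow> x \<sqsubseteq>\<^bsub>A\<^esub> y\<rbrakk> \<Longrightarrow> \<Squnion>\<^bsub>A\<^esub> S \<sqsubseteq>\<^bsub>A\<^esub> y"
      using A.sup_least[OF S] S unfolding least_def Upper_def by blast+
    show "least B (f (\<Squnion>\<^bsub>A\<^esub> S)) (Upper B (f ` S))"
    proof (rule least_UpperI)
      show "f ` S \<subseteq> carrier B" "f (\<Squnion>\<^bsub>A\<^esub> S) \<in> carrier B"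
        using S fc lA(1) by auto
      show "y \<sqsubseteq>\<^bsub>B\<^esub> f (\<Squnion>\<^bsub>A\<^esub> S)" if y: "y \<in> f ` S" for y
      proof -
        obtain x where x: "x \<in> S" "y = f x"
          using y by (rule imageE)
        then have "x \<in> carrier A"
          using S by blast
        then show ?thesis
          using ord[of x "\<Squnion>\<^bsub>A\<^esub> S"] lA(1) lA(2)[OF x(1)] x(2) by simp
      qed
      show "f (\<Squnion>\<^bsub>A\<^esub> S) \<sqsubseteq>\<^bsub>B\<^esub> y" if y: "y \<in> Upper B (f ` S)" for y
      proof -
        have "y \<in> f ` carrier A"
          using y unfolding Upper_def img by (rule IntD2)
        then obtain z where z: "z \<in> carrier A" "y = f z"
          by blast
        have "x \<sqsubseteq>\<^bsub>A\<^esub> z" if x: "x \<in> S" for x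
        proof -
          have "f x \<sqsubseteq>\<^bsub>B\<^esub> f z"
            using x y z(2) fc S unfolding Upper_def by auto
          then show ?thesis
            using ord[of x z] x z S by blast
        qed
        then show ?thesis
          using lA(1) lA(3)[OF z(1)] z ord[of "\<Squnion>\<^bsub>A\<^esub> S" z] by simp
      qed
    qed
  qed
  have bot: "f \<bottom>\<^bsub>A\<^esub> = \<bottom>\<^bsub>B\<^esub>"
    using sup[of "{}"] by (simp add: sup_empty)
  have less: "f x \<sqsubset>\<^bsub>B\<^esub> f y \<longleftrightarrow> x \<sqsubset>\<^bsub>A\<^esub> y" if "x \<in> carrier A" "y \<in> carrier A" for x y
    using that ord inj_on_eq_iff[OF inj] by (simp add: A.lless_eq B.lless_eq)
  have "f a \<in> atoms B" if a: "a \<in> atoms A" for a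
  proof -
    have a': "a \<in> carrier A" "\<bottom>\<^bsub>A\<^esub> \<sqsubset>\<^bsub>A\<^esub> a"
      "\<And>z. \<lbrakk>z \<in> carrier A; \<bottom>\<^bsub>A\<^esub> \<sqsubset>\<^bsub>A\<^esub> z\<rbrakk> \<Longrightarrow> \<not> z \<sqsubset>\<^bsub>A\<^esub> a"
      using a by (simp_all add: atoms_def covers_def)
    have "\<not> (\<bottom>\<^bsub>B\<^esub> \<sqsubset>\<^bsub>B\<^esub> f z \<and> f z \<sqsubset>\<^bsub>B\<^esub> f a)" if "z \<in> carrier A" for z
      using a' that less[of "\<bottom>\<^bsub>A\<^esub>" z] less[of z a] bot by auto
    moreover have "\<bottom>\<^bsub>B\<^esub> \<sqsubset>\<^bsub>B\<^esub> f a"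
      using a' less[of "\<bottom>\<^bsub>A\<^esub>" a] bot by simp
    ultimately show ?thesis
      using fc[OF a'(1)] unfolding atoms_def covers_def img[symmetric] by simp
  qed
  then have "\<forall>a \<in> atoms A. restrict f (carrier A) a \<in> atoms B \<or> restrict f (carrier A) a = \<bottom>\<^bsub>B\<^esub>"
    by (simp add: atoms_def)
  moreover have "restrict f (carrier A) (\<Squnion>\<^bsub>A\<^esub> S) = \<Squnion>\<^bsub>B\<^esub> (restrict f (carrier A) ` S)"
    if S: "S \<subseteq> carrier A" for S
  proof -
    have "restrict f (carrier A) ` S = f ` S"
      using S by auto
    then show ?thesis
      using sup[OF S] A.sup_carrier[OF S] by simp
  qed
  moreover have "restrict f (carrier A) \<in> carrier A \<rightarrow>\<^sub>E carrier B"
    using fc by simp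
  ultimately show ?thesis
    unfolding mem_Hom_GLat_iff by blast
qed

lemma order_iso_in_Iso_GLat:
  assumes A: "geometric_lattice A" and B: "geometric_lattice B"
    and bij: "bij_betw f (carrier A) (carrier B)"
    and ord: "\<And>x y. \<lbrakk>x \<in> carrier A; y \<in> carrier A\<rbrakk> \<Longrightarrow> f x \<sqsubseteq>\<^bsub>B\<^esub> f y \<longleftrightarrow> x \<sqsubseteq>\<^bsub>A\<^esub> y"
  shows "restrict f (carrier A) \<in> Iso GLat A B"
proof -
  define g where "g = inv_into (carrier A) f"
  have g: "bij_betw g (carrier B) (carrier A)"
    unfolding g_def by (rule bij_betw_inv_into[OF bij])
  have fg: "f (g y) = y" "g y \<in> carrier A" if "y \<in> carrier B" for y
    using that bij unfolding g_def bij_betw_def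
    by (auto simp: f_inv_into_f inv_into_into)
  have gf: "g (f x) = x" "f x \<in> carrier B" if "x \<in> carrier A" for x
    using that bij unfolding g_def bij_betw_def by (auto simp: inv_into_f_f)
  have "restrict g (carrier B) \<in> Hom GLat B A"
  proof (rule order_iso_in_Hom_GLat[OF B A g])
    show "g x \<sqsubseteq>\<^bsub>A\<^esub> g y \<longleftrightarrow> x \<sqsubseteq>\<^bsub>B\<^esub> y" if "x \<in> carrier B" "y \<in> carrier B" for x y
      using ord[of "g x" "g y"] fg that by simp
  qed
  moreover have "restrict f (carrier A) \<in> Hom GLat A B"
    by (rule order_iso_in_Hom_GLat[OF A B bij ord])
  ultimately have "inverse_pair GLat A B (restrict f (carrier A)) (restrict g (carrier B))"
    unfolding inverse_pair_def using fg gf by (auto simp: compose_def fun_eq_iff)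
  then show ?thesis
    unfolding Iso_def by blast
qed


section \<open>Functoriality\<close>

lemma strong_mapsD:
  assumes "f \<in> strong_maps M N"
  shows "f \<in> ground M \<rightarrow>\<^sub>E ground N" "F \<in> flats N \<Longrightarrow> {x \<in> ground M. f x \<in> F} \<in> flats M"
  using assms unfolding strong_maps_def by auto

lemma ident_strong_map: "(\<lambda>x\<in>ground M. x) \<in> strong_maps M M"
proof -
  have "{x \<in> ground M. (if x \<in> ground M then x else undefined) \<in> F} = F" if "F \<in> flats M" for F
    using that unfolding flats_def by auto
  then show ?thesis
    unfolding strong_maps_def by (auto simp: restrict_def)
qed

lemma compose_strong_maps:
  assumes f: "f \<in> strong_maps M N" and g: "g \<in> strong_maps N P"
  shows "compose (ground M) g f \<in> strong_maps M P"
proof -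
  have f': "f \<in> ground M \<rightarrow> ground N" and g': "g \<in> ground N \<rightarrow> ground P"
    using strong_mapsD(1)[OF f] strong_mapsD(1)[OF g] by auto
  have "{x \<in> ground M. compose (ground M) g f x \<in> F} \<in> flats M" if "F \<in> flats P" for F
  proof -
    have "{x \<in> ground M. compose (ground M) g f x \<in> F} = {x \<in> ground M. f x \<in> {y \<in> ground N. g y \<in> F}}"
      using f' by (auto simp: compose_eq)
    then show ?thesis
      using strong_mapsD(2)[OF f strong_mapsD(2)[OF g that]] by simp
  qed
  moreover have "compose (ground M) g f \<in> ground M \<rightarrow>\<^sub>E ground P"
    using f' g' by (auto simp: compose_def)
  ultimately show ?thesis
    unfolding strong_maps_def by simp
qed

lemma category_Matr: "category (Matr :: ('a matroid, 'a \<Rightarrow> 'a) cat)"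
proof (unfold_locales, goal_cases)
  case (3 A B f)
  then show ?case
    using strong_mapsD(1) by (fastforce simp: Matr_def compose_Id PiE_def)
next
  case (4 A B f)
  then show ?case
    using strong_mapsD(1) by (fastforce simp: Matr_def Id_compose PiE_def)
next
  case (5 A B D E f g h)
  then have "f \<in> ground A \<rightarrow> ground B"
    using strong_mapsD(1) by (fastforce simp: Matr_def)
  then show ?case
    by (simp add: Matr_def compose_assoc)
qed (auto simp: Matr_def ident_strong_map intro: compose_strong_maps)

lemma category_Matr_pointed: "category (Matr_pointed :: ('a pointed_matroid, 'a \<Rightarrow> 'a) cat)"
proof (unfold_locales, goal_cases)
  case (1 A)
  then show ?case
    by (simp add: Matr_pointed_def ident_strong_map loops_def)
next
  case (2 A B D f g)
  then show ?case
    by (auto simp: Matr_pointed_def loops_def compose_eq intro: compose_strong_maps)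
next
  case (3 A B f)
  then show ?case
    using strong_mapsD(1) by (fastforce simp: Matr_pointed_def compose_Id PiE_def)
next
  case (4 A B f)
  then show ?case
    using strong_mapsD(1) by (fastforce simp: Matr_pointed_def Id_compose PiE_def)
next
  case (5 A B D E f g h)
  then have "f \<in> ground A \<rightarrow> ground B"
    using strong_mapsD(1) by (fastforce simp: Matr_pointed_def)
  then show ?case
    by (simp add: Matr_pointed_def compose_assoc)
qed

lemma strong_map_cl_image:
  assumes M: "matroid M" and N: "matroid N" and f: "f \<in> strong_maps M N" and X: "X \<subseteq> ground M"
  shows "cl N (f ` cl M X) = cl N (f ` X)"
proof -
  interpret M: matroid M by fact
  interpret N: matroid N by fact
  have fX: "f ` X \<subseteq> ground N"
    using strong_mapsD(1)[OF f] X by auto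
  \<comment> \<open>The preimage of the flat spanned by the image of \<open>X\<close> is a flat above \<open>X\<close>.\<close>
  let ?G = "{x \<in> ground M. f x \<in> cl N (f ` X)}"
  have "?G \<in> flats M"
    by (rule strong_mapsD(2)[OF f N.cl_in_flats[OF fX]])
  moreover have "X \<subseteq> ?G"
    using N.cl_superset[OF fX] X by auto
  ultimately have "cl M X \<subseteq> ?G"
    using M.cl_subset_flat_iff[OF X] by blast
  then have "f ` cl M X \<subseteq> cl N (f ` X)"
    by auto
  then have "cl N (f ` cl M X) \<subseteq> cl N (f ` X)"
    using N.cl_mono N.cl_cl[OF fX] by metis
  moreover have "cl N (f ` X) \<subseteq> cl N (f ` cl M X)"
    by (intro N.cl_mono image_mono M.cl_superset X)
  ultimately show ?thesis
    by blast
qed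

lemma flat_map_in_Hom_GLat:
  assumes M: "matroid M" and N: "matroid N" and f: "f \<in> strong_maps M N"
  shows "(\<lambda>X\<in>flats M. cl N (f ` X)) \<in> Hom GLat (flat_lattice M) (flat_lattice N)"
proof -
  interpret M: matroid M by fact
  interpret N: matroid N by fact
  let ?h = "\<lambda>X\<in>flats M. cl N (f ` X)"
  have f_ground: "f ` X \<subseteq> ground N" if "X \<subseteq> ground M" for X
    using strong_mapsD(1)[OF f] that by auto
  have h_flats: "cl N (f ` X) \<in> flats N" if "X \<in> flats M" for X
    by (rule N.cl_in_flats[OF f_ground[OF M.flats_ground[OF that]]])
  have "?h (\<Squnion>\<^bsub>flat_lattice M\<^esub> S) = \<Squnion>\<^bsub>flat_lattice N\<^esub> (?h ` S)" if S: "S \<subseteq> flats M" for S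
  proof -
    have US: "\<Union>S \<subseteq> ground M"
      using S M.flats_ground by blast
    have "?h (\<Squnion>\<^bsub>flat_lattice M\<^esub> S) = cl N (f ` cl M (\<Union>S))"
      using M.cl_in_flats[OF US] by (simp add: M.sup_flat_lattice[OF S])
    also have "\<dots> = cl N (\<Union>X\<in>S. f ` X)"
      using strong_map_cl_image[OF M N f US] by (simp add: image_Union)
    also have "\<dots> = cl N (\<Union>X\<in>S. cl N (f ` X))"
      using S M.flats_ground f_ground by (intro N.cl_UN_cl[symmetric]) blast
    also have "(\<Union>X\<in>S. cl N (f ` X)) = \<Union>(?h ` S)"
      using S by (auto simp: subset_iff)
    also have "cl N (\<Union>(?h ` S)) = \<Squnion>\<^bsub>flat_lattice N\<^esub> (?h ` S)"
      using S h_flats by (intro N.sup_flat_lattice[symmetric]) (auto simp: subset_iff)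
    finally show ?thesis .
  qed
  moreover have "?h A \<in> atoms (flat_lattice N) \<or> ?h A = \<bottom>\<^bsub>flat_lattice N\<^esub>"
    if A: "A \<in> atoms (flat_lattice M)" for A
  proof -
    have "A \<in> flats M"
      using A unfolding atoms_def by simp
    obtain x where x: "x \<in> A" "A = cl M {x}" "x \<in> ground M"
      using M.atom_not_subset_cl_empty[OF A] M.atom_eq_cl_singleton[OF A]
        M.flats_ground[OF \<open>A \<in> flats M\<close>] by blast
    then have "?h A = cl N {f x}"
      using strong_map_cl_image[OF M N f, of "{x}"] \<open>A \<in> flats M\<close> by simp
    then show ?thesis
      using N.cl_singleton_atom_or_bottom[of "f x"] f_ground[of "{x}"] x(3) by simp
  qed
  ultimately show ?thesis
    using h_flats unfolding mem_Hom_GLat_iff by auto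
qed

text \<open>
  Stated for any category of matroids and strong maps, so as to cover the plain and the pointed
  matroids at once.
\<close>

lemma is_functor_flat_functor:
  fixes C :: "(('a, 'r) matroid_scheme, 'a \<Rightarrow> 'a) cat"
  assumes C: "category C" and Ob: "\<And>M. M \<in> Ob C \<Longrightarrow> matroid M"
    and Hom: "\<And>M N. Hom C M N \<subseteq> strong_maps M N"
    and ident: "\<And>M. ident C M = (\<lambda>x\<in>ground M. x)"
    and comp: "\<And>M N P g f. comp C M N P g f = compose (ground M) g f"
  shows "is_functor C GLat flat_functor"
  unfolding is_functor_def
proof (intro conjI ballI C category_GLat)
  fix M assume M: "M \<in> Ob C"
  then interpret M: matroid M by (rule Ob)
  show "on_Ob flat_functor M \<in> Ob GLat"
    using M.geometric_lattice_flats by (simp add: flat_functor_def)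
  have "cl M ((\<lambda>x\<in>ground M. x) ` X) = X" if "X \<in> flats M" for X
  proof -
    have "(\<lambda>x\<in>ground M. x) ` X = X"
      using M.flats_ground[OF that] by (auto simp: image_iff subset_iff)
    then show ?thesis
      using M.cl_flat[OF that] by simp
  qed
  then have "(\<lambda>X\<in>flats M. cl M ((\<lambda>x\<in>ground M. x) ` X)) = (\<lambda>X\<in>flats M. X)"
    by (intro restrict_ext)
  then show "on_Hom flat_functor M M (ident C M) = ident GLat (on_Ob flat_functor M)"
    by (simp only: flat_functor_def ident ident_GLat carrier_flat_lattice cat_map.simps)
next
  fix M N f assume "M \<in> Ob C" "N \<in> Ob C" "f \<in> Hom C M N"
  then show "on_Hom flat_functor M N f \<in> Hom GLat (on_Ob flat_functor M) (on_Ob flat_functor N)"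
    using flat_map_in_Hom_GLat[OF Ob Ob, of M N f] Hom by (auto simp: flat_functor_def)
next
  fix M N P f g
  assume "M \<in> Ob C" "N \<in> Ob C" "P \<in> Ob C" "f \<in> Hom C M N" "g \<in> Hom C N P"
  then have M: "matroid M" and N: "matroid N" and P: "matroid P"
    and f: "f \<in> strong_maps M N" and g: "g \<in> strong_maps N P"
    using Ob Hom by auto
  interpret M: matroid M by fact
  interpret N: matroid N by fact
  have "cl P (compose (ground M) g f ` X) = cl P (g ` cl N (f ` X)) \<and> cl N (f ` X) \<in> flats N"
    if "X \<in> flats M" for X
  proof -
    have X: "X \<subseteq> ground M" "f ` X \<subseteq> ground N"
      using strong_mapsD(1)[OF f] M.flats_ground[OF that] by auto
    then have "compose (ground M) g f ` X = g ` f ` X"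
      unfolding image_image by (intro image_cong) (auto simp: compose_eq)
    then show ?thesis
      using strong_map_cl_image[OF N P g X(2)] N.cl_in_flats[OF X(2)] by simp
  qed
  then have "(\<lambda>X\<in>flats M. cl P (compose (ground M) g f ` X)) =
      compose (flats M) (\<lambda>Y\<in>flats N. cl P (g ` Y)) (\<lambda>X\<in>flats M. cl N (f ` X))"
    unfolding compose_def[of "flats M"] by (intro restrict_ext) simp
  then show "on_Hom flat_functor M P (comp C M N P g f) =
      comp GLat (on_Ob flat_functor M) (on_Ob flat_functor N) (on_Ob flat_functor P)
        (on_Hom flat_functor N P g) (on_Hom flat_functor M N f)"
    by (simp add: flat_functor_def comp)
qed

section \<open>Lifting lattice maps to strong maps\<close>

lemma (in matroid) GLat_map_cl_UN:
  assumes N: "matroid N" and h: "h \<in> Hom GLat (flat_lattice M) (flat_lattice N)"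
    and I: "\<And>i. i \<in> I \<Longrightarrow> A i \<in> flats M"
  shows "h (cl M (\<Union>i\<in>I. A i)) = cl N (\<Union>i\<in>I. h (A i))"
proof -
  interpret N: matroid N by fact
  have AI: "A ` I \<subseteq> flats M" and hAI: "h ` A ` I \<subseteq> flats N"
    using I h unfolding mem_Hom_GLat_iff by auto
  have "h (\<Squnion>\<^bsub>flat_lattice M\<^esub> (A ` I)) = \<Squnion>\<^bsub>flat_lattice N\<^esub> (h ` A ` I)"
    using h AI unfolding mem_Hom_GLat_iff by simp
  then have "h (cl M (\<Union>(A ` I))) = cl N (\<Union>(h ` A ` I))"
    unfolding sup_flat_lattice[OF AI] N.sup_flat_lattice[OF hAI] .
  then show ?thesis
    by (simp add: image_image)
qed

text \<open>
  The loop \<open>c\<close> supplies an image for the elements that \<open>h\<close> collapses to the least flat; all other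
  elements are sent to any representative of the atom prescribed by \<open>h\<close>. Loops of \<open>M\<close> are always
  collapsed, because \<open>h\<close> preserves the empty join, and sending them to \<open>c\<close> is what makes the
  lifted map preserve distinguished loops.
\<close>

lemma strong_map_of_GLat_map:
  assumes M: "matroid M" and N: "matroid N" and c: "c \<in> loops N"
    and h: "h \<in> Hom GLat (flat_lattice M) (flat_lattice N)"
  shows "\<exists>f \<in> strong_maps M N. (\<forall>x \<in> loops M. f x = c) \<and> on_Hom flat_functor M N f = h"
proof -
  interpret M: matroid M by fact
  interpret N: matroid N by fact
  have c': "c \<in> cl N {}" "c \<in> ground N"
    using c N.loops_eq_cl_empty N.cl_ground by auto
  have cl_c: "cl N {c} = cl N {}"
    using N.cl_Un_cl[of "{}" "{c}"] N.cl_cl[of "{}"] c' by (simp add: insert_absorb)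
  have h_flats: "h X \<in> flats N" if "X \<in> flats M" for X
    using h that unfolding mem_Hom_GLat_iff by auto
  have h_bot: "h (cl M {}) = cl N {}"
    using Hom_GLat_bottom[OF h] by (simp add: M.bottom_flat_lattice N.bottom_flat_lattice)
  have cl_flats: "cl M {x} \<in> flats M" if "x \<in> ground M" for x
    using M.cl_in_flats[of "{x}"] that by simp
  \<comment> \<open>The equation alone would let a loop \<open>x\<close> go to any loop of \<open>N\<close>; the last conjunct
    pins it to \<open>c\<close>.\<close>
  have rep: "\<exists>y \<in> ground N. cl N {y} = h (cl M {x}) \<and> (x \<in> cl M {} \<longrightarrow> y = c)"
    if x: "x \<in> ground M" for x
  proof (cases "h (cl M {x}) = cl N {}")
    case True
    then show ?thesis
      using c' cl_c by auto
  next
    case False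
    then have "cl M {x} \<noteq> cl M {}"
      using h_bot by auto
    then have x': "x \<notin> cl M {}" "cl M {x} \<in> atoms (flat_lattice M)"
      using M.cl_singleton_atom_or_bottom[OF x] M.cl_singleton_atom[OF x]
        M.cl_Un_cl[of "{}" "{x}"] M.cl_cl[of "{}"] x
      by (auto simp: M.bottom_flat_lattice insert_absorb)
    then have at: "h (cl M {x}) \<in> atoms (flat_lattice N)"
      using h False unfolding mem_Hom_GLat_iff by (auto simp: N.bottom_flat_lattice)
    obtain y where y: "y \<in> h (cl M {x})" "h (cl M {x}) = cl N {y}"
      using N.atom_not_subset_cl_empty[OF at] N.atom_eq_cl_singleton[OF at] by blast
    then have "y \<in> ground N"
      using N.flats_ground[OF h_flats[OF cl_flats[OF x]]] by blast
    then show ?thesis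
      using y x' by auto
  qed
  then obtain f0 where f0: "\<And>x. x \<in> ground M \<Longrightarrow> f0 x \<in> ground N \<and> cl N {f0 x} = h (cl M {x})
      \<and> (x \<in> cl M {} \<longrightarrow> f0 x = c)"
    by metis
  define f where "f = restrict f0 (ground M)"
  have f: "f x \<in> ground N" "cl N {f x} = h (cl M {x})" "x \<in> cl M {} \<Longrightarrow> f x = c"
    if "x \<in> ground M" for x
    using f0[OF that] that unfolding f_def by auto
  have h_mono: "h X \<subseteq> h Y" if XY: "X \<in> flats M" "Y \<in> flats M" "X \<subseteq> Y" for X Y
  proof -
    have "X \<union> Y = Y"
      using XY by blast
    then have "h Y = cl N (h X \<union> h Y)"
      using M.GLat_map_cl_UN[OF N h, of "{X, Y}" "\<lambda>Z. Z"] XY M.cl_flat by auto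
    then show ?thesis
      using N.cl_superset[of "h X \<union> h Y"] N.flats_ground h_flats XY by auto
  qed
  have "{x \<in> ground M. f x \<in> F} \<in> flats M" if F: "F \<in> flats N" for F
  proof -
    \<comment> \<open>The preimage is the largest flat that \<open>h\<close> maps below \<open>F\<close>.\<close>
    define \<X> where "\<X> = {X \<in> flats M. h X \<subseteq> F}"
    define G where "G = cl M (\<Union>\<X>)"
    have U: "\<Union>\<X> \<subseteq> ground M"
      unfolding \<X>_def using M.flats_ground by blast
    then have G: "G \<in> flats M"
      unfolding G_def by (rule M.cl_in_flats)
    have "h G = cl N (\<Union>X\<in>\<X>. h X)"
      using M.GLat_map_cl_UN[OF N h, of \<X> "\<lambda>Z. Z"] unfolding G_def \<X>_def by simp
    then have hG: "h G \<subseteq> F"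
      using N.cl_subset_flat_iff[OF _ F, of "\<Union>X\<in>\<X>. h X"] N.flats_ground[OF F]
      unfolding \<X>_def by auto
    have "f x \<in> F \<longleftrightarrow> x \<in> G" if x: "x \<in> ground M" for x
    proof -
      have "f x \<in> F \<longleftrightarrow> h (cl M {x}) \<subseteq> F"
        using N.cl_subset_flat_iff[OF _ F, of "{f x}"] f[OF x] by simp
      also have "\<dots> \<longleftrightarrow> cl M {x} \<subseteq> G"
      proof
        assume "h (cl M {x}) \<subseteq> F"
        then have "cl M {x} \<subseteq> \<Union>\<X>"
          unfolding \<X>_def using cl_flats[OF x] by blast
        then show "cl M {x} \<subseteq> G"
          unfolding G_def using M.cl_superset[OF U] by blast
      next
        assume "cl M {x} \<subseteq> G"
        then show "h (cl M {x}) \<subseteq> F"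
          using h_mono[OF cl_flats[OF x] G] hG by blast
      qed
      also have "\<dots> \<longleftrightarrow> x \<in> G"
        using M.cl_subset_flat_iff[OF _ G, of "{x}"] x by simp
      finally show ?thesis .
    qed
    then have "{x \<in> ground M. f x \<in> F} = G"
      using M.flats_ground[OF G] by blast
    then show ?thesis
      using G by simp
  qed
  then have "f \<in> strong_maps M N"
    unfolding strong_maps_def using f(1) by (auto simp: f_def)
  moreover have "f x = c" if "x \<in> loops M" for x
    using that f(3) M.loops_eq_cl_empty M.cl_ground by blast
  moreover have "cl N (f ` X) = h X" if X: "X \<in> flats M" for X
  proof -
    have Xg: "x \<in> ground M" if "x \<in> X" for x
      using M.flats_ground[OF X] that by blast
    have "cl N (f ` X) = cl N (\<Union>x\<in>X. cl N {f x})"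
      using N.cl_UN_cl[of X "\<lambda>x. {f x}"] f(1) Xg by (auto simp: UNION_singleton_eq_range)
    also have "\<dots> = cl N (\<Union>x\<in>X. h (cl M {x}))"
      using f(2) Xg by simp
    also have "\<dots> = h (cl M (\<Union>x\<in>X. cl M {x}))"
      using M.GLat_map_cl_UN[OF N h, of X "\<lambda>x. cl M {x}"] cl_flats Xg by simp
    also have "cl M (\<Union>x\<in>X. cl M {x}) = X"
      using M.cl_UN_cl[of X "\<lambda>x. {x}"] Xg M.cl_flat[OF X] by simp
    finally show ?thesis .
  qed
  then have "on_Hom flat_functor M N f = h"
    using h unfolding mem_Hom_GLat_iff flat_functor_def
    by (auto simp: fun_eq_iff PiE_def extensional_def)
  ultimately show ?thesis
    by blast
qed

section \<open>Transport along an identification of isomorphic objects\<close>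

lemma (in category) inverse_pair_unique:
  assumes "A \<in> Ob C" "B \<in> Ob C" "inverse_pair C A B f g" "inverse_pair C A B f g'"
  shows "g = g'"
proof -
  have "g = comp C B B A g (comp C B A B f g')"
    using assms comp_ident_right unfolding inverse_pair_def by simp
  also have "\<dots> = comp C B A A (comp C A B A g f) g'"
    using assms comp_assoc[of B A B A g' f g] unfolding inverse_pair_def by simp
  also have "\<dots> = g'"
    using assms comp_ident_left unfolding inverse_pair_def by simp
  finally show ?thesis .
qed

lemma (in category) inverse_pair_inv_arrow:
  assumes "A \<in> Ob C" "B \<in> Ob C" "f \<in> Iso C A B"
  shows "inverse_pair C A B f (inv_arrow C A B f)"
proof -
  obtain g where g: "inverse_pair C A B f g"
    using assms unfolding Iso_def by blast
  then show ?thesis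
    unfolding inv_arrow_def by (rule theI) (use inverse_pair_unique assms g in blast)
qed

text \<open>
  Conjugation by the chosen isomorphisms is a bijection on hom-sets, so surjectivity on a hom-set
  survives the identification.
\<close>

lemma identified_functor_surj:
  assumes D: "category D" and ident: "identification D r i"
    and ob: "on_Ob F M \<in> Ob D" "on_Ob F N \<in> Ob D"
    and surj: "\<And>h. h \<in> Hom D (on_Ob F M) (on_Ob F N) \<Longrightarrow> \<exists>f \<in> S. on_Hom F M N f = h"
    and g: "g \<in> Hom D (r (on_Ob F M)) (r (on_Ob F N))"
  shows "\<exists>f \<in> S. on_Hom (identified_functor D r i F) M N f = g"
proof -
  interpret category D by fact
  define A B where "A = on_Ob F M" and "B = on_Ob F N"
  note [simp] = A_def[symmetric] B_def[symmetric]
  have ob: "A \<in> Ob D" "B \<in> Ob D" "r A \<in> Ob D" "r B \<in> Ob D"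
    and iso: "i A \<in> Iso D A (r A)" "i B \<in> Iso D B (r B)"
    using ident ob unfolding identification_def by auto
  define j k where "j = inv_arrow D A (r A) (i A)" and "k = inv_arrow D B (r B) (i B)"
  have inv: "i A \<in> Hom D A (r A)" "j \<in> Hom D (r A) A" "comp D (r A) A (r A) (i A) j = ident D (r A)"
    "i B \<in> Hom D B (r B)" "k \<in> Hom D (r B) B" "comp D (r B) B (r B) (i B) k = ident D (r B)"
    using inverse_pair_inv_arrow ob iso unfolding j_def k_def inverse_pair_def by auto
  have g: "g \<in> Hom D (r A) (r B)"
    using g by simp
  define u where "u = comp D A (r A) (r B) g (i A)"
  define h where "h = comp D A (r B) B k u"
  have u: "u \<in> Hom D A (r B)" and h: "h \<in> Hom D A B"
    unfolding u_def h_def using comp_Hom inv ob g by auto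
  obtain f where f: "f \<in> S" "on_Hom F M N f = h"
    using surj h by auto
  have "comp D (r A) B (r B) (i B) (comp D (r A) A B h j) = comp D (r A) A (r B) (comp D A B (r B) (i B) h) j"
    using comp_assoc[of "r A" A B "r B" j h "i B"] ob inv h by simp
  also have "comp D A B (r B) (i B) h = u"
    using comp_assoc[of A "r B" B "r B" u k "i B"] comp_ident_left[of A "r B" u] ob inv u
    unfolding h_def by simp
  also have "comp D (r A) A (r B) u j = g"
    using comp_assoc[of "r A" A "r A" "r B" j "i A" g] comp_ident_right[of "r A" "r B" g] ob inv g
    unfolding u_def by simp
  finally show ?thesis
    using f unfolding identified_functor_def j_def by (auto simp: Let_def)
qed

section \<open>Adjoining a loop\<close>

definition add_loop :: "'a \<Rightarrow> ('a, 'r) matroid_scheme \<Rightarrow> ('a, 'r) matroid_scheme" where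
  "add_loop e M = M\<lparr>ground := insert e (ground M)\<rparr>"

context matroid
begin

lemma matroid_add_loop: "matroid (add_loop e M)"
  using finite_ground indep_subset indep_empty indep_mono augment
  unfolding add_loop_def by unfold_locales auto

context
  fixes e
  assumes e: "e \<notin> ground M"
begin

lemma rank_insert_new: "rank M (insert e X) = rank M X"
proof -
  have "{I \<in> indep M. I \<subseteq> insert e X} = {I \<in> indep M. I \<subseteq> X}"
    using e indep_subset by blast
  then show ?thesis
    unfolding rank_def by simp
qed

lemma cl_add_loop: "cl (add_loop e M) X = insert e (cl M X)"
proof -
  have "rank (add_loop e M) Y = rank M Y" for Y
    unfolding rank_def add_loop_def by simp
  then show ?thesis
    using rank_insert_new unfolding cl_def add_loop_def by auto
qed

lemma cl_insert_new: "cl M (insert e X) = cl M X"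
proof -
  have "rank M (insert x (insert e X)) = rank M (insert x X)" for x
    using rank_insert_new[of "insert x X"] by (simp add: insert_commute)
  then show ?thesis
    unfolding cl_def by (simp add: rank_insert_new)
qed

lemma flats_add_loop: "flats (add_loop e M) = insert e ` flats M"
proof
  show "flats (add_loop e M) \<subseteq> insert e ` flats M"
  proof
    fix F assume "F \<in> flats (add_loop e M)"
    then have F: "insert e (cl M F) = F"
      unfolding flats_def cl_add_loop by simp
    then have "cl M (cl M F) = cl M F"
      using cl_insert_new[of "cl M F"] by simp
    then have "cl M F \<in> flats M"
      using cl_ground unfolding flats_def by blast
    then show "F \<in> insert e ` flats M"
      using F by blast
  qed
  show "insert e ` flats M \<subseteq> flats (add_loop e M)"
    unfolding flats_def cl_add_loop by (auto simp: cl_insert_new add_loop_def)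
qed

lemma loop_add_loop: "e \<in> loops (add_loop e M)"
  unfolding loops_def flats_add_loop by (simp add: add_loop_def)

text \<open>
  The new loop belongs to every flat and so carries no order-theoretic information.
\<close>

lemma Iso_add_loop: "Iso GLat (flat_lattice M) (flat_lattice (add_loop e M)) \<noteq> {}"
proof -
  have e': "e \<notin> F" if "F \<in> flats M" for F
    using e flats_ground[OF that] by blast
  interpret N: matroid "add_loop e M"
    by (rule matroid_add_loop)
  have "restrict (insert e) (carrier (flat_lattice M)) \<in> Iso GLat (flat_lattice M) (flat_lattice (add_loop e M))"
  proof (rule order_iso_in_Iso_GLat[OF geometric_lattice_flats N.geometric_lattice_flats])
    show "bij_betw (insert e) (carrier (flat_lattice M)) (carrier (flat_lattice (add_loop e M)))"
      using e' by (auto simp: bij_betw_def flats_add_loop inj_on_def insert_ident)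
  qed (use e' in auto)
  then show ?thesis
    by blast
qed

end

end

section \<open>Near fullness and fullness\<close>

theorem proposition7p6:
  fixes r :: "'a set gorder \<Rightarrow> 'a set gorder"
    and i :: "'a set gorder \<Rightarrow> 'a set \<Rightarrow> 'a set"
  assumes "infinite (UNIV :: 'a set)"
    and "identification GLat r i"
  shows "(is_functor Matr GLat L_Matr \<and>
          nearly_full Matr (identified_cat GLat r) (identified_functor GLat r i L_Matr)) \<and>
         (is_functor Matr_pointed GLat L_pointed \<and>
          full_functor Matr_pointed (identified_cat GLat r) (identified_functor GLat r i L_pointed))"
proof (intro conjI)
  note ident = \<open>identification GLat r i\<close>
  have Hom_ident [simp]: "Hom (identified_cat GLat r) = Hom GLat"
    by (simp add: identified_cat_def)
  have on_Ob_ident [simp]: "on_Ob (identified_functor GLat r i flat_functor) M = r (flat_lattice M)"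
    for M :: "('a, 'r) matroid_scheme"
    by (simp add: identified_functor_def flat_functor_def)
  have on_Ob_flat [simp]: "on_Ob flat_functor M = flat_lattice M" for M :: "('a, 'r) matroid_scheme"
    by (simp add: flat_functor_def)
  show "is_functor Matr GLat L_Matr"
    by (rule is_functor_flat_functor[OF category_Matr]) (auto simp: Matr_def)
  show "is_functor Matr_pointed GLat L_pointed"
    by (rule is_functor_flat_functor[OF category_Matr_pointed]) (auto simp: Matr_pointed_def)
  show "nearly_full Matr (identified_cat GLat r) (identified_functor GLat r i L_Matr)"
    unfolding nearly_full_def
  proof (intro ballI)
    fix A B g
    assume "A \<in> on_Ob (identified_functor GLat r i L_Matr) ` Ob Matr"
      and "B \<in> on_Ob (identified_functor GLat r i L_Matr) ` Ob Matr"
      and g: "g \<in> Hom (identified_cat GLat r) A B"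
    then obtain M N :: "'a matroid" where M: "matroid M" "A = r (flat_lattice M)"
      and N: "matroid N" "B = r (flat_lattice N)"
      by (auto simp: Matr_def identified_functor_def flat_functor_def)
    interpret M: matroid M by fact
    interpret N: matroid N by fact
    obtain e where e: "e \<notin> ground N"
      using ex_new_if_finite[OF assms(1) N.finite_ground] by blast
    define N' where "N' = add_loop e N"
    interpret N': matroid N'
      unfolding N'_def by (rule N.matroid_add_loop)
    \<comment> \<open>Replacing \<open>N\<close> by \<open>N'\<close> keeps the representative but possibly not the identification with it,
      so the morphism is carried back to the lattice of \<open>N'\<close> itself.\<close>
    have B: "r (flat_lattice N') = B"
      using ident N.Iso_add_loop[OF e] N.geometric_lattice_flats N'.geometric_lattice_flats
      unfolding identification_def N N'_def by (metis Ob_GLat mem_Collect_eq)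
    have "\<exists>f \<in> strong_maps M N'. on_Hom (identified_functor GLat r i L_Matr) M N' f = g"
    proof (rule identified_functor_surj[OF category_GLat ident])
      fix h assume "h \<in> Hom GLat (on_Ob L_Matr M) (on_Ob L_Matr N')"
      then show "\<exists>f \<in> strong_maps M N'. on_Hom L_Matr M N' f = h"
        using strong_map_of_GLat_map[OF M(1) N'.matroid_axioms] N.loop_add_loop[OF e]
        unfolding N'_def by fastforce
    qed (use M.geometric_lattice_flats N'.geometric_lattice_flats g M B in simp_all)
    then show "\<exists>M \<in> Ob Matr. \<exists>N \<in> Ob Matr. \<exists>f \<in> Hom Matr M N.
        on_Ob (identified_functor GLat r i L_Matr) M = A \<and>
        on_Ob (identified_functor GLat r i L_Matr) N = B \<and>
        on_Hom (identified_functor GLat r i L_Matr) M N f = g"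
      using M N'.matroid_axioms B by (fastforce simp: Matr_def)
  qed
  show "full_functor Matr_pointed (identified_cat GLat r) (identified_functor GLat r i L_pointed)"
    unfolding full_functor_def
  proof (intro ballI)
    fix M N :: "'a pointed_matroid" and g
    assume "M \<in> Ob Matr_pointed" "N \<in> Ob Matr_pointed"
      and g: "g \<in> Hom (identified_cat GLat r) (on_Ob (identified_functor GLat r i L_pointed) M)
        (on_Ob (identified_functor GLat r i L_pointed) N)"
    then have M: "matroid M" "point M \<in> loops M" and N: "matroid N" "point N \<in> loops N"
      by (auto simp: Matr_pointed_def)
    show "\<exists>f \<in> Hom Matr_pointed M N. on_Hom (identified_functor GLat r i L_pointed) M N f = g"
    proof (rule identified_functor_surj[OF category_GLat ident])
      fix h assume "h \<in> Hom GLat (on_Ob L_pointed M) (on_Ob L_pointed N)"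
      then show "\<exists>f \<in> Hom Matr_pointed M N. on_Hom L_pointed M N f = h"
        using strong_map_of_GLat_map[OF M(1) N, of h] M(2) by (fastforce simp: Matr_pointed_def)
    qed (use M N g matroid.geometric_lattice_flats in simp_all)
  qed
qed

end
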